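(* Let $S$ be a semigroup of bounded exponent. Then the cyclic graph $\Gamma(S)$ is regular if and only if $|S_f|=|S_{f'}|$ for all $f,f'\in E(S)$ and, for each $f\in E(S)$, there exist $a\in S$ and a positive integer $r$ such that one of the following holds: (i) $S_f=\langle a : a^{1+r}=a\rangle$; (ii) $S_f=\langle a : a^{2+r}=a^2\rangle$; (iii) $S_f=\langle a : a^{3+r}=a^3\rangle$, where $r$ is odd.
   Context: For a subset $X$ of a semigroup $S$, $\langle X\rangle$ denotes the subsemigroup generated by $X$; a semigroup is monogenic if it equals $\langle a\rangle=\{a^k : k\in\mathbb{N}\}$ for some element $a$, where $\mathbb{N}=\{1,2,\dots\}$. The cyclic graph $\Gamma(S)$ is the simple undirected graph with vertex set $S$ in which two distinct vertices $x,y$ are adjacent if and only if $\langle x,y\rangle$ is a monogenic subsemigroup of $S$. $E(S)$ is the set of idempotents of $S$. $S$ is of bounded exponent if there is a positive integer $n$ such that for every $x\in S$, $x^n$ is an idempotent. For $f\in E(S)$, $S_f=\{a\in S : a^m=f \text{ for some } m\in\mathbb{N}\}$. If $\langle a\rangle$ is finite, the index of $a$ is the least $m\in\mathbb{N}$ such that $a^m=a^y$ for some $y\in\mathbb{N}$, $y\ne m$, and the period of $a$ is the least $r\in\mathbb{N}$ with $a^{m+r}=a^m$, where $m$ is the index. $\langle a : a^{m+r}=a^m\rangle$ denotes the monogenic semigroup $\langle a\rangle$ generated by an element $a$ of index $m$ and period $r$ (it has exactly $m+r-1$ elements); an equality such as $S_f=\langle a : a^{m+r}=a^m\rangle$ means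 that $S_f=\langle a\rangle$ with $a$ of index $m$ and period $r$. *)

theory Defs
  imports HOL.Hull "HOL-Library.Equipollence"
begin

section \<open>Semigroups\<close>

text \<open>
  A semigroup is (the universe of) a type of class \<^class>\<open>semigroup_mult\<close>.
\<close>

text \<open>
  The class has no unit, so \<^const>\<open>power\<close> is not available. \<open>spow a k\<close> is the power
  with positive exponent \<open>k\<close>; the value at exponent \<open>0\<close> is junk (it is \<open>a\<close>), and every use
  below restricts to positive exponents.
\<close>

definition spow :: "'a::semigroup_mult \<Rightarrow> nat \<Rightarrow> 'a" where
  "spow a k = ((\<lambda>x. x * a) ^^ (k - 1)) a"

lemma spow_1 [simp]: "spow a (Suc 0) = a"
  by (simp add: spow_def)

lemma spow_Suc: "k > 0 \<Longrightarrow> spow a (Suc k) = spow a k * a"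
  by (cases k) (simp_all add: spow_def)

lemma spow_add:
  assumes "j > 0" "k > 0"
  shows "spow a (j + k) = spow a j * spow a k"
proof -
  have "spow a (j + Suc n) = spow a j * spow a (Suc n)" for n
  proof (induction n)
    case 0
    then show ?case using assms(1) by (simp add: spow_Suc)
  next
    case (Suc n)
    have "spow a (j + Suc (Suc n)) = spow a (j + Suc n) * a"
      using spow_Suc[of "j + Suc n" a] by simp
    then show ?case
      using Suc spow_Suc[of "Suc n" a] by (simp add: mult.assoc)
  qed
  from this[of "k - 1"] show ?thesis using assms(2) by simp
qed

definition subsemigroup :: "'a::semigroup_mult set \<Rightarrow> bool" where
  "subsemigroup T \<longleftrightarrow> (\<forall>x\<in>T. \<forall>y\<in>T. x * y \<in> T)"

definition generated :: "'a::semigroup_mult set \<Rightarrow> 'a set" where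
  "generated X = subsemigroup hull X"

definition monogenic :: "'a::semigroup_mult set \<Rightarrow> bool" where
  "monogenic T \<longleftrightarrow> (\<exists>a. T = generated {a})"

lemma generated_singleton: "generated {a} = {spow a k | k. k > 0}"
  unfolding generated_def
proof (rule hull_unique)
  show "{a} \<subseteq> {spow a k | k. k > 0}"
    by (auto intro!: exI[of _ "Suc 0"])
  show "subsemigroup {spow a k | k. k > 0}"
    unfolding subsemigroup_def by (auto simp: spow_add[symmetric])
next
  fix T assume T: "{a} \<subseteq> T" "subsemigroup T"
  have "spow a (Suc n) \<in> T" for n
    by (induction n) (use T in \<open>auto simp: spow_Suc[of "Suc _"] subsemigroup_def\<close>)
  then show "{spow a k | k. k > 0} \<subseteq> T"
    by (auto simp: gr0_conv_Suc)
qed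

definition idempotents :: "'a::semigroup_mult set" where
  "idempotents = {e. e * e = e}"

definition bounded_exponent :: "'a::semigroup_mult itself \<Rightarrow> bool" where
  "bounded_exponent _ \<longleftrightarrow> (\<exists>n>0. \<forall>x::'a. spow x n \<in> idempotents)"

text \<open>The set $S_f$ of all elements having the idempotent \<open>f\<close> as a power.\<close>

definition idem_component :: "'a::semigroup_mult \<Rightarrow> 'a set" where
  "idem_component f = {a. \<exists>m>0. spow a m = f}"

text \<open>
  Index and period are meaningful only if \<open>generated {a}\<close> is finite; otherwise the
  \<open>LEAST\<close> operators range over an empty predicate.
\<close>

definition sindex :: "'a::semigroup_mult \<Rightarrow> nat" where
  "sindex a = (LEAST m. m > 0 \<and> (\<exists>y>0. y \<noteq> m \<and> spow a m = spow a y))"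

definition speriod :: "'a::semigroup_mult \<Rightarrow> nat" where
  "speriod a = (LEAST r. r > 0 \<and> spow a (sindex a + r) = spow a (sindex a))"

text \<open>\<open>monogenic_of T a m r\<close> is $T = \langle a : a^{m+r} = a^m\rangle$.\<close>

definition monogenic_of :: "'a::semigroup_mult set \<Rightarrow> 'a \<Rightarrow> nat \<Rightarrow> nat \<Rightarrow> bool" where
  "monogenic_of T a m r \<longleftrightarrow>
     T = generated {a} \<and> finite (generated {a}) \<and> sindex a = m \<and> speriod a = r"


section \<open>Simple graphs\<close>

text \<open>A simple undirected graph is given by its vertices and its edges, two-element sets of vertices.\<close>

type_synonym 'a ugraph = "'a set \<times> 'a set set"

definition neighbours :: "'a ugraph \<Rightarrow> 'a \<Rightarrow> 'a set" where
  "neighbours G v = {w \<in> fst G. {v, w} \<in> snd G}"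

text \<open>
  Vertices may have infinite degree, so degrees are compared as cardinals, by equipollence
  of the neighbourhoods; \<^const>\<open>card\<close> would confuse infinite degree with degree \<open>0\<close>.
\<close>

definition regular_graph :: "'a ugraph \<Rightarrow> bool" where
  "regular_graph G \<longleftrightarrow> (\<forall>u\<in>fst G. \<forall>v\<in>fst G. neighbours G u \<approx> neighbours G v)"

definition cyclic_graph :: "'a::semigroup_mult ugraph" where
  "cyclic_graph = (UNIV, {{x, y} | x y. x \<noteq> y \<and> monogenic (generated {x, y})})"

end

theory Submission
  imports Defs "HOL-Number_Theory.Cong"
begin

text \<open>
  Call \<open>{w. \<langle>v, w\<rangle> is monogenic}\<close> the closed neighbourhood of \<open>v\<close>; it is \<open>v\<close> together with its
  neighbours, so regularity says that all closed neighbourhoods are equipollent. A monogenic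
  semigroup in which elements have idempotent powers contains exactly one idempotent. Hence adjacent
  vertices lie in the same component \<open>S\<^sub>f\<close>, and the closed neighbourhood of the idempotent \<open>f\<close> is
  the whole of \<open>S\<^sub>f\<close>.

  Suppose that the graph is regular. The components are then equipollent. By bounded exponent some
  \<open>a \<in> S\<^sub>f\<close> generates a monogenic subsemigroup of largest size, and this maximality makes
  \<open>\<langle>a\<rangle>\<close> the closed neighbourhood of \<open>a\<close>. It is finite and equipollent to \<open>S\<^sub>f\<close>, which contains
  it; so \<open>S\<^sub>f = \<langle>a\<rangle>\<close>. Now that \<open>S\<^sub>f\<close> is finite, every closed neighbourhood of one of its
  elements must be all of \<open>S\<^sub>f\<close>, that is, \<open>S\<^sub>f\<close> is a clique. The pair \<open>a\<^sup>2, a\<^sup>3\<close> is the only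
  obstruction: if the index exceeds 2, then a generator of \<open>\<langle>a\<^sup>2, a\<^sup>3\<rangle>\<close> can only be \<open>a\<^sup>2\<close>,
  and \<open>a\<^sup>3\<close> is a power of \<open>a\<^sup>2\<close> only if the index is 3 and the period is odd
  (\<open>index_period_if_square_cube_adjacent\<close>).

  Conversely, in each of the three cases \<open>S\<^sub>f\<close> is a clique (\<open>clique_if_small_index\<close>), so that the
  closed neighbourhood of each vertex is its component. Two powers with exponents from the index on lie in a finite
  cyclic group, where Bezout's identity modulo the period yields a common generator
  (\<open>monogenic_generated_beyond_index\<close>); few pairs remain.
\<close>

section \<open>Powers and generated subsemigroups\<close>

lemma spow_spow:
  assumes "i > 0" "j > 0"
  shows "spow (spow a i) j = spow a (i * j)"
proof -
  have "spow (spow a i) (Suc n) = spow a (i * Suc n)" for n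
  proof (induction n)
    case (Suc n)
    have "spow a (i * Suc (Suc n)) = spow a (i * Suc n + i)"
      by (simp add: algebra_simps)
    also have "\<dots> = spow a (i * Suc n) * spow a i"
      using assms by (intro spow_add) auto
    finally show ?case
      using Suc by (simp add: spow_Suc)
  qed simp
  from this[of "j - 1"] assms show ?thesis by simp
qed

lemma spow_idempotent:
  assumes "e \<in> idempotents" "k > 0"
  shows "spow e k = e"
proof -
  have "spow e (Suc n) = e" for n
    using assms(1) by (induction n) (auto simp: spow_Suc[of "Suc _"] idempotents_def)
  from this[of "k - 1"] assms(2) show ?thesis by simp
qed

lemma mem_generated_singleton: "x \<in> generated {c} \<longleftrightarrow> (\<exists>k>0. x = spow c k)"
  by (auto simp: generated_singleton)

lemma spow_in_generated: "k > 0 \<Longrightarrow> spow c k \<in> generated {c}"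
  by (auto simp: generated_singleton)

lemma self_in_generated: "c \<in> generated {c}"
  by (metis spow_1 spow_in_generated zero_less_Suc)

lemma generated_superset: "X \<subseteq> generated X"
  by (simp add: generated_def hull_subset)

lemma generated_minimal: "X \<subseteq> T \<Longrightarrow> subsemigroup T \<Longrightarrow> generated X \<subseteq> T"
  by (simp add: generated_def hull_minimal)

lemma subsemigroup_generated: "subsemigroup (generated X)"
  unfolding generated_def by (rule hull_in) (auto simp: subsemigroup_def)

lemma generated_least: "X \<subseteq> generated Y \<Longrightarrow> generated X \<subseteq> generated Y"
  by (simp add: generated_minimal subsemigroup_generated)

lemma monogenic_generated_pair_iff:
  "monogenic (generated {x, y}) \<longleftrightarrow>
    (\<exists>c \<in> generated {x, y}. x \<in> generated {c} \<and> y \<in> generated {c})"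
proof
  assume "monogenic (generated {x, y})"
  then obtain c where "generated {x, y} = generated {c}"
    by (auto simp: monogenic_def)
  then show "\<exists>c \<in> generated {x, y}. x \<in> generated {c} \<and> y \<in> generated {c}"
    using generated_superset[of "{x, y}"] self_in_generated[of c] by auto
next
  assume "\<exists>c \<in> generated {x, y}. x \<in> generated {c} \<and> y \<in> generated {c}"
  then obtain c where "c \<in> generated {x, y}" "x \<in> generated {c}" "y \<in> generated {c}"
    by blast
  then have "generated {x, y} = generated {c}"
    by (intro equalityI generated_least) auto
  then show "monogenic (generated {x, y})"
    by (auto simp: monogenic_def)
qed

lemma monogenic_generated_if_power:
  assumes "y \<in> generated {x}"
  shows "monogenic (generated {x, y})"
  using assms generated_superset[of "{x, y}"] self_in_generated[of x]
  by (auto simp: monogenic_generated_pair_iff)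


section \<open>Index and period\<close>

lemma spow_add_mult_period:
  assumes "spow a (m + r) = spow a m" "m > 0" "r > 0"
  shows "spow a (m + j + q * r) = spow a (m + j)"
proof -
  have step: "spow a (m + i + r) = spow a (m + i)" for i
  proof (cases "i = 0")
    case False
    then have "spow a ((m + r) + i) = spow a (m + i)"
      using assms by (simp add: spow_add)
    then show ?thesis by (simp add: add_ac)
  qed (use assms in simp)
  show ?thesis
  proof (induction q)
    case (Suc q)
    then show ?case
      using step[of "j + q * r"] by (simp add: add_ac)
  qed simp
qed

lemma spow_eq_if_cong:
  assumes period: "spow a (m + r) = spow a m" "m > 0" "r > 0"
    and "i \<ge> m" "j \<ge> m" "[i = j] (mod r)"
  shows "spow a i = spow a j"
proof -
  have eq: "spow a i = spow a j" if "i \<le> j" "i \<ge> m" "[i = j] (mod r)" for i j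
  proof -
    have "\<exists>q. j = q * r + i"
      using that cong_le_nat[of i j r] by (simp add: cong_sym_eq[of i j])
    then obtain q where "j = i + q * r"
      by (auto simp: add.commute)
    then show ?thesis
      using spow_add_mult_period[OF period, of "i - m" q] that by simp
  qed
  show ?thesis
    using eq[of i j] eq[of j i] assms by (metis cong_sym nat_le_linear)
qed

lemma generated_subset_if_period:
  assumes "spow a (m + r) = spow a m" "m > 0" "r > 0"
  shows "generated {a} \<subseteq> spow a ` {..<m + r}"
proof
  fix x assume "x \<in> generated {a}"
  then obtain k where k: "x = spow a k" "k > 0"
    by (auto simp: mem_generated_singleton)
  show "x \<in> spow a ` {..<m + r}"
  proof (cases "k < m")
    case False
    have "spow a (m + (k - m) mod r + (k - m) div r * r) = spow a (m + (k - m) mod r)"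
      by (rule spow_add_mult_period[OF assms])
    moreover have "m + (k - m) mod r + (k - m) div r * r = k"
      using False by simp
    ultimately have "x = spow a (m + (k - m) mod r)"
      using k by simp
    then show ?thesis
      using assms(3) by auto
  qed (use k in auto)
qed

lemma spow_less_index_unique:
  assumes "spow a k = spow a l" "k > 0" "l > 0" "k < sindex a"
  shows "l = k"
  using not_less_Least[OF assms(4)[unfolded sindex_def]] assms(1-3) by metis

lemma
  assumes "finite (generated {a})"
  shows sindex_pos: "sindex a > 0"
    and speriod_pos: "speriod a > 0"
    and spow_index_add_period: "spow a (sindex a + speriod a) = spow a (sindex a)"
proof -
  have "\<not> inj_on (spow a) {0<..}"
  proof
    assume "inj_on (spow a) {0<..}"
    moreover have "finite (spow a ` {0<..})"
      by (rule finite_subset[OF _ assms]) (auto simp: spow_in_generated)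
    ultimately show False
      using finite_imageD infinite_Ioi by blast
  qed
  then obtain i j where "i > 0" "j > 0" "i \<noteq> j" "spow a i = spow a j"
    by (auto simp: inj_on_def)
  then have "\<exists>m. m > 0 \<and> (\<exists>y>0. y \<noteq> m \<and> spow a m = spow a y)"
    by blast
  from LeastI_ex[OF this, folded sindex_def]
  obtain y where y: "sindex a > 0" "y > 0" "y \<noteq> sindex a" "spow a (sindex a) = spow a y"
    by blast
  have "y > sindex a"
    using y spow_less_index_unique[of a y "sindex a"] by fastforce
  then have "\<exists>r. r > 0 \<and> spow a (sindex a + r) = spow a (sindex a)"
    using y by (intro exI[of _ "y - sindex a"]) simp
  from LeastI_ex[OF this, folded speriod_def] y(1)
  show "sindex a > 0" "speriod a > 0" "spow a (sindex a + speriod a) = spow a (sindex a)"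
    by auto
qed

lemma speriod_dvd:
  assumes "finite (generated {a})" "spow a (sindex a + s) = spow a (sindex a)"
  shows "speriod a dvd s"
proof (rule ccontr)
  let ?m = "sindex a" and ?r = "speriod a"
  note period = spow_index_add_period[OF assms(1)] sindex_pos[OF assms(1)] speriod_pos[OF assms(1)]
  assume "\<not> ?r dvd s"
  then have pos: "s mod ?r > 0" by (simp add: dvd_eq_mod_eq_0)
  have "spow a (?m + s mod ?r) = spow a (?m + s mod ?r + s div ?r * ?r)"
    by (rule spow_add_mult_period[OF period, symmetric])
  also have "\<dots> = spow a ?m"
    using assms(2) by (simp add: add.assoc)
  finally have "?r \<le> s mod ?r"
    using pos unfolding speriod_def[of a] by (intro Least_le) auto
  then show False
    using mod_less_divisor[OF period(3), of s] by linarith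
qed


section \<open>Cliques in monogenic semigroups\<close>

lemma bezout_mod_pos:
  fixes i j r :: nat
  assumes "r > 0"
  obtains u v where "u > 0" "v > 0" "[u * i + v * j = gcd i j] (mod r)"
proof -
  obtain s t where st: "s * int i + t * int j = gcd (int i) (int j)"
    using bezout_int by blast
  \<comment> \<open>The Bezout coefficients may be negative or zero, and exponents must be positive.\<close>
  define u v where "u = nat (s mod int r) + r" and "v = nat (t mod int r) + r"
  have "[int u = s] (mod int r)" "[int v = t] (mod int r)"
    using assms by (auto simp: u_def v_def cong_def)
  then have "[int u * int i + int v * int j = s * int i + t * int j] (mod int r)"
    by (intro cong_add cong_mult cong_refl)
  then have "[int (u * i + v * j) = int (gcd i j)] (mod int r)"
    by (simp add: st)
  then have "[u * i + v * j = gcd i j] (mod r)"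
    using cong_int_iff by blast
  moreover have "u > 0" "v > 0"
    using assms by (auto simp: u_def v_def)
  ultimately show thesis using that by blast
qed

text \<open>
  The powers from the index on depend only on the exponent modulo the period, as in a cyclic group.
  So if \<open>u i + v j\<close> with positive \<open>u, v\<close> is congruent to \<open>gcd i j\<close>, then the product
  \<open>x\<^sup>u y\<^sup>v\<close> generates both \<open>x = a\<^sup>i\<close> and \<open>y = a\<^sup>j\<close>.
\<close>

lemma monogenic_generated_beyond_index:
  assumes period: "spow a (m + r) = spow a m" "m > 0" "r > 0" and "i \<ge> m" "j \<ge> m"
  shows "monogenic (generated {spow a i, spow a j})"
proof -
  have pos: "i > 0" "j > 0" using assms by auto
  obtain u v where uv: "u > 0" "v > 0" and bez: "[u * i + v * j = gcd i j] (mod r)"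
    using bezout_mod_pos[OF \<open>r > 0\<close>] .
  define k where "k = u * i + v * j"
  have "u * i \<ge> i" using uv by simp
  then have k: "k \<ge> m" "k > 0"
    using \<open>m > 0\<close> \<open>i \<ge> m\<close> unfolding k_def by linarith+
  have power: "spow a l \<in> generated {spow a k}" if "gcd i j dvd l" "l \<ge> m" for l
  proof -
    obtain q where q: "l = gcd i j * q" using \<open>gcd i j dvd l\<close> ..
    then have "q > 0" using that assms by (cases q) auto
    have "[k * q = l] (mod r)"
      unfolding q k_def by (intro cong_mult bez cong_refl)
    moreover have "k * q \<ge> m"
      using k \<open>q > 0\<close> by (metis le_trans mult_le_mono2 nat_mult_1_right Suc_leI One_nat_def)
    ultimately have "spow a l = spow a (k * q)"
      using that spow_eq_if_cong[OF period] by metis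
    also have "\<dots> = spow (spow a k) q"
      using k \<open>q > 0\<close> by (simp add: spow_spow)
    finally show ?thesis
      using \<open>q > 0\<close> by (auto simp: mem_generated_singleton)
  qed
  have "spow (spow a i) u \<in> generated {spow a i, spow a j}"
    "spow (spow a j) v \<in> generated {spow a i, spow a j}"
    using generated_least[of "{spow a i}" "{spow a i, spow a j}"]
      generated_least[of "{spow a j}" "{spow a i, spow a j}"]
      generated_superset[of "{spow a i, spow a j}"] spow_in_generated uv
    by blast+
  then have "spow (spow a i) u * spow (spow a j) v \<in> generated {spow a i, spow a j}"
    using subsemigroup_generated unfolding subsemigroup_def by blast
  moreover have "spow (spow a i) u * spow (spow a j) v = spow a k"
    using pos uv by (simp add: spow_spow spow_add[symmetric] k_def mult.commute)
  ultimately show ?thesis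
    using power assms by (auto simp: monogenic_generated_pair_iff)
qed

text \<open>
  The exponents below the index are 1, which gives a generator of everything, and in the third case 2.
  There an odd period helps: adding the period to an odd exponent makes it even,
  so that all powers from the index on are powers of \<open>a\<^sup>2\<close>.
\<close>

lemma clique_if_small_index:
  assumes fin: "finite (generated {a})"
    and small: "sindex a \<le> 2 \<or> sindex a = 3 \<and> odd (speriod a)"
    and "x \<in> generated {a}" "y \<in> generated {a}"
  shows "monogenic (generated {x, y})"
proof -
  let ?m = "sindex a" and ?r = "speriod a"
  note period = spow_index_add_period[OF fin] sindex_pos[OF fin] speriod_pos[OF fin]
  have pair: "monogenic (generated {spow a i, spow a j})" if ij: "0 < i" "i \<le> j" for i j
  proof -
    consider "i = 1" | "i = j" | "i \<ge> ?m" | "1 < i" "i < j" "i < ?m"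
      using ij by linarith
    then show ?thesis
    proof cases
      case 1
      then show ?thesis
        using ij by (simp add: monogenic_generated_if_power spow_in_generated)
    next
      case 2
      then show ?thesis
        by (auto simp: monogenic_def)
    next
      case 3
      then show ?thesis
        using ij monogenic_generated_beyond_index[OF period, of i j] by simp
    next
      case below: 4
      then have "\<not> ?m \<le> 2" by linarith
      then have "?m = 3" "odd ?r" using small by simp_all
      then have 4: "i = 2" "j > 2" "?m = 3" "odd ?r" using below by simp_all
      have "\<exists>l>0. spow a j = spow a (2 * l)"
      proof (cases "even j")
        case True
        then obtain l where "j = 2 * l" by (elim evenE)
        then show ?thesis using 4 by (intro exI[of _ l]) simp
      next
        case False
        then have "even (j + ?r)" using 4 by simp
        then obtain l where l: "j + ?r = 2 * l" by (elim evenE)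
        have "spow a j = spow a (j + ?r)"
          using 4 by (intro spow_eq_if_cong[OF period]) (auto simp: cong_def)
        moreover have "l > 0" using l 4 by linarith
        ultimately show ?thesis using l by metis
      qed
      then obtain l where "l > 0" "spow a j = spow a (2 * l)" by blast
      then have "spow a j = spow (spow a i) l"
        using 4 by (simp add: spow_spow)
      then have "spow a j \<in> generated {spow a i}"
        using \<open>l > 0\<close> by (simp add: spow_in_generated)
      then show ?thesis
        by (rule monogenic_generated_if_power)
    qed
  qed
  obtain i j where "x = spow a i" "y = spow a j" "i > 0" "j > 0"
    using assms by (auto simp: mem_generated_singleton)
  then show ?thesis
    using pair[of i j] pair[of j i] by (metis insert_commute nat_le_linear)
qed

text \<open>
  All elements of \<open>\<langle>a\<^sup>2, a\<^sup>3\<rangle>\<close> have exponents at least 2. If the index exceeds 2, then the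
  exponent of \<open>a\<^sup>2\<close> is unique and \<open>a\<^sup>2\<close> itself must be the generator. So \<open>a\<^sup>3 = a\<^sup>2\<^sup>l\<close> for some
  \<open>l\<close>, which bounds the index by 3; the period divides the odd number \<open>2 l - 3\<close>.
\<close>

lemma index_period_if_square_cube_adjacent:
  assumes fin: "finite (generated {a})"
    and mono: "monogenic (generated {spow a 2, spow a 3})"
    and index: "sindex a > 2"
  shows "sindex a = 3 \<and> odd (speriod a)"
proof -
  obtain c where c: "c \<in> generated {spow a 2, spow a 3}"
    "spow a 2 \<in> generated {c}" "spow a 3 \<in> generated {c}"
    using mono by (auto simp: monogenic_generated_pair_iff)
  have "generated {spow a 2, spow a 3} \<subseteq> {spow a k | k. k \<ge> 2}"
  proof (rule generated_minimal)
    have "\<exists>k\<ge>2. spow a i * spow a j = spow a k" if "i \<ge> 2" "j \<ge> 2" for i j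
      using that by (intro exI[of _ "i + j"]) (simp add: spow_add)
    then show "subsemigroup {spow a k | k. k \<ge> 2}"
      by (auto simp: subsemigroup_def)
  qed auto
  then obtain k where k: "c = spow a k" "k \<ge> 2"
    using c(1) by blast
  obtain j where j: "j > 0" "spow a 2 = spow a (k * j)"
    using c(2) k by (auto simp: mem_generated_singleton spow_spow)
  then have "k * j = 2"
    using k index by (intro spow_less_index_unique[where a = a]) auto
  then have "k = 2"
    using k by (metis dvd_triv_left dvd_imp_le le_antisym zero_less_numeral)
  obtain l where l: "l > 0" "spow a 3 = spow a (2 * l)"
    using c(3) k \<open>k = 2\<close> by (auto simp: mem_generated_singleton spow_spow)
  have odd: "2 * l \<noteq> 3" by presburger
  have "\<not> sindex a > 3"
    using spow_less_index_unique[OF l(2)] l(1) odd by auto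
  then have three: "sindex a = 3" using index by simp
  have "2 * l \<noteq> 2"
    using spow_less_index_unique[of a 2 3] l(2) index by fastforce
  then have "2 * l > 3" using l(1) odd by linarith
  then have "speriod a dvd (2 * l - 3)"
    using l three by (intro speriod_dvd[OF fin]) simp
  moreover have "odd (2 * l - 3)"
    using \<open>2 * l > 3\<close> by simp
  ultimately show ?thesis
    using three dvd_trans by blast
qed


section \<open>Closed neighbourhoods in the cyclic graph\<close>

definition closed_neighbourhood :: "'a::semigroup_mult \<Rightarrow> 'a set" where
  "closed_neighbourhood v = {w. monogenic (generated {v, w})}"

lemma insert_neighbours:
  "insert v (neighbours cyclic_graph v) = closed_neighbourhood v"
proof -
  have "monogenic (generated {v, v})"
    by (auto simp: monogenic_def)
  then show ?thesis
    by (auto simp: neighbours_def cyclic_graph_def closed_neighbourhood_def doubleton_eq_iff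
        insert_commute)
qed

lemma regular_cyclic_graph_iff:
  "regular_graph (cyclic_graph :: 'a::semigroup_mult ugraph) \<longleftrightarrow>
    (\<forall>(u :: 'a) (v :: 'a). closed_neighbourhood u \<approx> closed_neighbourhood v)"
proof -
  have "v \<notin> neighbours cyclic_graph v" for v :: 'a
    by (auto simp: neighbours_def cyclic_graph_def doubleton_eq_iff)
  then have "neighbours cyclic_graph u \<approx> neighbours cyclic_graph v \<longleftrightarrow>
      closed_neighbourhood u \<approx> closed_neighbourhood v" for u v :: 'a
    by (simp add: insert_neighbours[symmetric] insert_eqpoll_insert_iff)
  then show ?thesis
    by (simp add: regular_graph_def cyclic_graph_def)
qed

lemma idem_component_eq:
  fixes f :: "'a::semigroup_mult"
  assumes "n > 0" "\<And>x::'a. spow x n \<in> idempotents" "f \<in> idempotents"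
  shows "idem_component f = {x. spow x n = f}"
proof -
  have "spow x n = f" if "m > 0" "spow x m = f" for m and x :: 'a
  proof -
    have "spow x n = spow (spow x n) m"
      using assms that by (simp add: spow_idempotent)
    also have "\<dots> = spow (spow x m) n"
      using spow_spow[OF assms(1) that(1), of x] spow_spow[OF that(1) assms(1), of x]
      by (simp only: mult.commute)
    also have "\<dots> = f"
      using assms that by (simp add: spow_idempotent)
    finally show ?thesis .
  qed
  then show ?thesis
    using assms(1) by (auto simp: idem_component_def)
qed

lemma spow_exponent_eq_if_in_generated:
  fixes x c :: "'a::semigroup_mult"
  assumes "n > 0" "\<And>x::'a. spow x n \<in> idempotents" "x \<in> generated {c}"
  shows "spow x n = spow c n"
proof -
  obtain k where "k > 0" "x = spow c k"
    using assms by (auto simp: mem_generated_singleton)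
  then have "spow x n = spow (spow c n) k"
    using assms(1) by (simp add: spow_spow mult.commute)
  then show ?thesis
    using assms \<open>k > 0\<close> by (simp add: spow_idempotent)
qed

text \<open>A monogenic subsemigroup contains only one idempotent.\<close>

lemma closed_neighbourhood_subset_component:
  fixes f :: "'a::semigroup_mult"
  assumes "n > 0" "\<And>x::'a. spow x n \<in> idempotents" "f \<in> idempotents"
    and "v \<in> idem_component f"
  shows "closed_neighbourhood v \<subseteq> idem_component f"
proof
  fix w assume "w \<in> closed_neighbourhood v"
  then obtain c where "v \<in> generated {c}" "w \<in> generated {c}"
    by (auto simp: closed_neighbourhood_def monogenic_generated_pair_iff)
  then have "spow w n = spow v n"
    using spow_exponent_eq_if_in_generated[OF assms(1,2)] by metis
  then show "w \<in> idem_component f"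
    using assms(4) by (simp add: idem_component_eq[OF assms(1-3)])
qed

lemma idempotent_in_component: "f \<in> idem_component f"
  unfolding idem_component_def by (auto intro: exI[of _ "Suc 0"])

lemma closed_neighbourhood_idempotent:
  fixes f :: "'a::semigroup_mult"
  assumes "n > 0" "\<And>x::'a. spow x n \<in> idempotents" "f \<in> idempotents"
  shows "closed_neighbourhood f = idem_component f"
proof
  show "closed_neighbourhood f \<subseteq> idem_component f"
    by (rule closed_neighbourhood_subset_component[OF assms idempotent_in_component])
  have "monogenic (generated {f, w})" if "w \<in> idem_component f" for w
    using that monogenic_generated_if_power[of f w]
    by (auto simp: idem_component_def insert_commute spow_in_generated)
  then show "idem_component f \<subseteq> closed_neighbourhood f"
    by (auto simp: closed_neighbourhood_def)
qed

lemma finite_generated_if_exponent: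
  assumes "n > 0" "spow x n \<in> idempotents"
  shows "finite (generated {x})" "card (generated {x}) \<le> 2 * n"
proof -
  have "spow x (n + n) = spow x n"
    using assms by (simp add: spow_add idempotents_def)
  then have sub: "generated {x} \<subseteq> spow x ` {..<n + n}"
    using assms(1) by (intro generated_subset_if_period)
  then show "finite (generated {x})"
    using finite_subset by blast
  have "card (generated {x}) \<le> card (spow x ` {..<n + n})"
    using sub by (intro card_mono) auto
  also have "\<dots> \<le> 2 * n"
    using card_image_le[of "{..<n + n}" "spow x"] by simp
  finally show "card (generated {x}) \<le> 2 * n" .
qed

text \<open>
  Bounded exponent bounds the sizes of the subsemigroups \<open>\<langle>x\<rangle>\<close>, so a largest one exists in each
  component. A generator of \<open>\<langle>v, w\<rangle>\<close> generates a subsemigroup containing \<open>\<langle>v\<rangle>\<close>, hence equal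
  to it when \<open>\<langle>v\<rangle>\<close> is largest.
\<close>

lemma exists_closed_neighbourhood_eq_generated:
  fixes f :: "'a::semigroup_mult"
  assumes "n > 0" "\<And>x::'a. spow x n \<in> idempotents" "f \<in> idempotents"
  obtains v where "v \<in> idem_component f" "closed_neighbourhood v = generated {v}"
proof -
  note fin = finite_generated_if_exponent[OF assms(1,2)]
  have "\<exists>v. v \<in> idem_component f \<and>
      (\<forall>x. x \<in> idem_component f \<longrightarrow> card (generated {x}) \<le> card (generated {v}))"
    by (rule ex_has_greatest_nat[where b = "2 * n + 1"])
      (use idempotent_in_component fin(2) in \<open>auto simp: less_Suc_eq_le\<close>)
  then obtain v where v: "v \<in> idem_component f"
    and max: "\<And>x. x \<in> idem_component f \<Longrightarrow> card (generated {x}) \<le> card (generated {v})"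
    by blast
  have "w \<in> generated {v}" if w: "w \<in> closed_neighbourhood v" for w
  proof -
    obtain c where c: "v \<in> generated {c}" "w \<in> generated {c}"
      using w by (auto simp: closed_neighbourhood_def monogenic_generated_pair_iff)
    then have "c \<in> idem_component f"
      using v spow_exponent_eq_if_in_generated[OF assms(1,2) c(1)]
      by (simp add: idem_component_eq[OF assms])
    moreover have "generated {v} \<subseteq> generated {c}"
      using c by (intro generated_least) auto
    ultimately have "generated {v} = generated {c}"
      using max fin(1) by (meson card_seteq)
    then show ?thesis using c by simp
  qed
  then have "closed_neighbourhood v = generated {v}"
    by (auto simp: closed_neighbourhood_def monogenic_generated_if_power)
  then show thesis using that v by blast
qed


section \<open>Regular cyclic graphs\<close>

text \<open>
  This is where regularity forces finiteness: a component is equipollent to a finite subset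
  of itself, and then also to each closed neighbourhood inside it.
\<close>

lemma regular_component_monogenic_clique:
  fixes f :: "'a::semigroup_mult"
  assumes "n > 0" "\<And>x::'a. spow x n \<in> idempotents" "f \<in> idempotents"
    and regular: "\<And>(u :: 'a) (v :: 'a). closed_neighbourhood u \<approx> closed_neighbourhood v"
  obtains a where "idem_component f = generated {a}" "finite (generated {a})"
    "\<And>x y. x \<in> generated {a} \<Longrightarrow> y \<in> generated {a} \<Longrightarrow> monogenic (generated {x, y})"
proof -
  obtain a where a: "a \<in> idem_component f" "closed_neighbourhood a = generated {a}"
    using exists_closed_neighbourhood_eq_generated[OF assms(1-3)] .
  have fin: "finite (generated {a})"
    by (rule finite_generated_if_exponent(1)[OF assms(1,2)])
  have eqp: "closed_neighbourhood v \<approx> idem_component f" for v :: 'a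
    using regular[of v f] by (simp add: closed_neighbourhood_idempotent[OF assms(1-3)])
  have finf: "finite (idem_component f)"
    using eqp[of a] a fin eqpoll_finite_iff by metis
  have all: "closed_neighbourhood v = idem_component f" if "v \<in> idem_component f" for v
  proof (rule card_subset_eq[OF finf])
    show "closed_neighbourhood v \<subseteq> idem_component f"
      by (rule closed_neighbourhood_subset_component[OF assms(1-3) that])
    show "card (closed_neighbourhood v) = card (idem_component f)"
      using eqp[of v] finf by (metis eqpoll_finite_iff eqpoll_iff_card)
  qed
  have "idem_component f = generated {a}"
    using all a by simp
  then show thesis
    using that fin all by (auto simp: closed_neighbourhood_def)
qed

theorem theorem3p12:
  assumes "bounded_exponent TYPE('a::semigroup_mult)"
  shows "regular_graph (cyclic_graph :: 'a ugraph) \<longleftrightarrow>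
    (\<forall>f\<in>(idempotents :: 'a set). \<forall>f'\<in>(idempotents :: 'a set). idem_component f \<approx> idem_component f') \<and>
    (\<forall>f\<in>(idempotents :: 'a set). \<exists>a r. r > 0 \<and>
       (monogenic_of (idem_component f) a 1 r \<or>
        monogenic_of (idem_component f) a 2 r \<or>
        (monogenic_of (idem_component f) a 3 r \<and> odd r)))"
    (is "_ \<longleftrightarrow> ?equipollent \<and> ?monogenic")
proof -
  obtain n where "n > 0" "\<And>x::'a. spow x n \<in> idempotents"
    using assms by (auto simp: bounded_exponent_def)
  note exponent = this
  note nbh_idem = closed_neighbourhood_idempotent[OF exponent]
  show ?thesis
    unfolding regular_cyclic_graph_iff
  proof (intro iffI conjI)
    assume regular: "\<forall>(u :: 'a) (v :: 'a). closed_neighbourhood u \<approx> closed_neighbourhood v"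
    have "idem_component f \<approx> idem_component f'"
      if "f \<in> idempotents" "f' \<in> idempotents" for f f' :: 'a
      using regular nbh_idem[OF that(1)] nbh_idem[OF that(2)] by metis
    then show ?equipollent by blast
    show ?monogenic
    proof
      fix f :: 'a assume "f \<in> idempotents"
      then obtain a where a: "idem_component f = generated {a}" "finite (generated {a})"
        and clique: "\<And>x y. x \<in> generated {a} \<Longrightarrow> y \<in> generated {a} \<Longrightarrow>
          monogenic (generated {x, y})"
        using regular_component_monogenic_clique[OF exponent _ regular[rule_format]] by blast
      have "monogenic (generated {spow a 2, spow a 3})"
        by (intro clique spow_in_generated) auto
      then have "sindex a = 1 \<or> sindex a = 2 \<or> sindex a = 3 \<and> odd (speriod a)"
        using index_period_if_square_cube_adjacent[OF a(2)] sindex_pos[OF a(2)] by linarith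
      then show "\<exists>a r. r > 0 \<and>
          (monogenic_of (idem_component f) a 1 r \<or>
           monogenic_of (idem_component f) a 2 r \<or>
           (monogenic_of (idem_component f) a 3 r \<and> odd r))"
        using a speriod_pos[OF a(2)]
        by (intro exI[of _ a] exI[of _ "speriod a"]) (auto simp: monogenic_of_def)
    qed
  next
    assume "?equipollent \<and> ?monogenic"
    then have equipollent: ?equipollent and monogenic: ?monogenic by auto
    have nbh: "closed_neighbourhood v = idem_component (spow v n)" for v :: 'a
    proof
      have v: "v \<in> idem_component (spow v n)"
        using exponent(1) by (auto simp: idem_component_def)
      then show "closed_neighbourhood v \<subseteq> idem_component (spow v n)"
        using closed_neighbourhood_subset_component[OF exponent exponent(2)] by blast
      obtain a r where "monogenic_of (idem_component (spow v n)) a 1 r \<or>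
          monogenic_of (idem_component (spow v n)) a 2 r \<or>
          (monogenic_of (idem_component (spow v n)) a 3 r \<and> odd r)"
        using monogenic exponent(2)[of v] by blast
      then have "idem_component (spow v n) = generated {a}" "finite (generated {a})"
        "sindex a \<le> 2 \<or> sindex a = 3 \<and> odd (speriod a)"
        by (auto simp: monogenic_of_def)
      then show "idem_component (spow v n) \<subseteq> closed_neighbourhood v"
        using clique_if_small_index[of a v] v by (auto simp: closed_neighbourhood_def)
    qed
    show "\<forall>(u :: 'a) (v :: 'a). closed_neighbourhood u \<approx> closed_neighbourhood v"
      using equipollent exponent(2) by (simp add: nbh)
  qed
qed

end
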